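(* Let $A=A(D)$ be a real-valued statistic satisfying $f_1^{A}=f_0^{A}$. Let $T=T(D)$ be a test statistic and let $T_N=T_N(D)$ be a real-valued statistic such that $T_N$ and $A$ are independent under $H_0$ and under $H_1$, and $T=\psi(T_N,A)$ for some bivariate (measurable) function $\psi$. If the ratio $L^{T_N}(u)=f_1^{T_N}(u)/f_0^{T_N}(u)$ is a monotone function of $u$, then the $T_N$-based test is superior to the test based on $T$: whenever the two tests have the same type I error rate, the power of the $T_N$-based test is at least that of the $T$-based test.
   Context: Setting: $D$ is the observed data, taking values in a measurable space $(\mathbb{X},\Upsilon)$ with a $\sigma$-finite measure $\tau$. A simple null hypothesis $H_0$ is tested against a simple alternative $H_1$. Under $H_k$ ($k\in\{0,1\}$), $D$ has distribution $\Pr_k$ with density $f_k$ with respect to $\tau$, and $f_0(x)>0$, $f_1(x)>0$ for all $x\in\mathbb{X}$. A statistic is a measurable real-valued function of $D$. For a statistic $B=B(D)$, $f_k^{B}(u)$ is the probability density of $B(D)$ under $H_k$. Identities between densities are understood almost everywhere. Tests: the $T$-based test rejects $H_0$ when $T>C$ for a threshold $C$. The $T_N$-based test rejects $H_0$ for large values of $T_N$ ($T_N>C'$) if $L^{T_N}$ is increasing, and for small values of $T_N$ ($T_N<C'$) if $L^{T_N}$ is decreasing. The type I error rate and the power of a test are its rejection probabilities under $\Pr_0$ and $\Pr_1$ respectively. *)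

theory Defs
  imports "HOL-Probability.Probability"
begin

text \<open>A test is identified with its rejection region, and a test based on a statistic with the
  family of its rejection regions over all thresholds.\<close>

definition reject_large :: "'x measure \<Rightarrow> ('x \<Rightarrow> real) \<Rightarrow> 'x set set" where
  "reject_large M S = {{x \<in> space M. S x > C} | C. True}"

definition reject_small :: "'x measure \<Rightarrow> ('x \<Rightarrow> real) \<Rightarrow> 'x set set" where
  "reject_small M S = {{x \<in> space M. S x < C} | C. True}"

text \<open>\<open>P0\<close> and \<open>P1\<close> are the distributions of the data under the null and the alternative, so
  \<open>measure P0 R\<close> is the type I error rate and \<open>measure P1 R\<close> the power of the test \<open>R\<close>.\<close>

definition superior :: "'x measure \<Rightarrow> 'x measure \<Rightarrow> 'x set set \<Rightarrow> 'x set set \<Rightarrow> bool" where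
  "superior P0 P1 \<R> \<S> \<longleftrightarrow>
     (\<forall>R\<in>\<R>. \<forall>S\<in>\<S>. measure P0 R = measure P0 S \<longrightarrow> measure P1 S \<le> measure P1 R)"

text \<open>\<open>g\<close> is a version of the density of the real statistic \<open>B\<close> under \<open>P\<close> with respect to \<open>\<nu>\<close>
  (\<open>lborel\<close> for continuous statistics).\<close>

definition stat_density ::
    "'x measure \<Rightarrow> real measure \<Rightarrow> ('x \<Rightarrow> real) \<Rightarrow> (real \<Rightarrow> real) \<Rightarrow> bool" where
  "stat_density P \<nu> B g \<longleftrightarrow> (\<forall>u. 0 \<le> g u) \<and> distributed P \<nu> B (\<lambda>u. ennreal (g u))"

text \<open>The ratio is considered only where the denominator is positive: elsewhere it is undefined
  on paper, whereas \<open>x / 0 = 0\<close> here would impose a spurious constraint on monotonicity.\<close>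

definition increasing_ratio :: "(real \<Rightarrow> real) \<Rightarrow> (real \<Rightarrow> real) \<Rightarrow> bool" where
  "increasing_ratio g0 g1 \<longleftrightarrow> mono_on {u. 0 < g0 u} (\<lambda>u. g1 u / g0 u)"

definition decreasing_ratio :: "(real \<Rightarrow> real) \<Rightarrow> (real \<Rightarrow> real) \<Rightarrow> bool" where
  "decreasing_ratio g0 g1 \<longleftrightarrow> antimono_on {u. 0 < g0 u} (\<lambda>u. g1 u / g0 u)"

end

theory Submission imports Defs begin

text \<open>
  Both tests are events of the pair \<open>(TN, A)\<close>. By independence its law under \<open>H\<^sub>k\<close> is the
  product of the law of \<open>TN\<close>, with density \<open>gNk\<close>, and a law \<open>Q\<close> of \<open>A\<close> that is common to both
  hypotheses because the two densities of \<open>A\<close> agree. Hence \<open>(TN, A)\<close> has density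
  \<open>(u, a) \<mapsto> gNk u\<close> with respect to \<open>\<nu>N \<Otimes> Q\<close>, and the likelihood ratio of the pair is that of
  \<open>TN\<close> alone. Monotonicity says that a half-line of large (or small) values of \<open>TN\<close> is a region
  on which this ratio is at least as large as anywhere outside, so the Neyman--Pearson lemma
  (\<open>neyman_pearson_densities\<close>) makes the test based on \<open>TN\<close> most powerful among all events of
  \<open>(TN, A)\<close> of the same size, in particular at least as powerful as the test based on \<open>\<psi> (TN, A)\<close>.

  The ratio is controlled only where \<open>gN0\<close> is positive. The remaining values of \<open>TN\<close> are null
  under \<open>H\<^sub>0\<close>, hence under \<open>H\<^sub>1\<close>, since \<open>P1\<close> is absolutely continuous with respect to \<open>P0\<close>.
\<close>

lemma neyman_pearson_densities:
  fixes f0 f1 :: "'a \<Rightarrow> real" and k :: real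
  assumes [measurable]: "f0 \<in> borel_measurable M" "f1 \<in> borel_measurable M"
    and nonneg: "\<And>x. 0 \<le> f0 x" "\<And>x. 0 \<le> f1 x"
    and fin: "finite_measure (density M f0)" "finite_measure (density M f1)"
    and [measurable]: "R \<in> sets M" "S \<in> sets M"
    and size: "measure (density M f0) R = measure (density M f0) S"
    and inside: "AE x in M. x \<in> R \<longrightarrow> k * f0 x \<le> f1 x"
    and outside: "AE x in M. x \<notin> R \<longrightarrow> f1 x \<le> k * f0 x"
  shows "measure (density M f1) S \<le> measure (density M f1) R"
proof -
  have integrable_mult_indicator:
      "integrable M (\<lambda>x. f x * indicator E x)"
    and measure_eq: "measure (density M f) E = (\<integral>x. f x * indicator E x \<partial>M)"
    if f[measurable]: "f \<in> borel_measurable M" and "\<And>x. 0 \<le> f x"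
      and "finite_measure (density M f)" and [measurable]: "E \<in> sets M"
    for f :: "'a \<Rightarrow> real" and E
  proof -
    interpret D: finite_measure "density M f" by fact
    have "integrable (density M f) (indicator E :: 'a \<Rightarrow> real)"
      by (intro D.integrable_const_bound[where B = 1]) auto
    then show "integrable M (\<lambda>x. f x * indicator E x)"
      by (subst (asm) integrable_real_density) (use that in auto)
    have "measure (density M f) E = (\<integral>x. indicator E x \<partial>density M f)"
      using sets.sets_into_space[OF \<open>E \<in> sets M\<close>] by (simp add: Int_absorb2 Int_absorb1)
    also have "\<dots> = (\<integral>x. f x * indicator E x \<partial>M)"
      by (subst integral_real_density) (use that in auto)
    finally show "measure (density M f) E = (\<integral>x. f x * indicator E x \<partial>M)" .
  qed
  note int0 = integrable_mult_indicator[of f0] and int1 = integrable_mult_indicator[of f1]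
  note int = int0[OF _ nonneg(1) fin(1)] int1[OF _ nonneg(2) fin(2)]
  \<comment> \<open>The integrand is \<open>(1\<^sub>R - 1\<^sub>S) (f1 - k f0)\<close>, whose factors
    have no opposite signs almost everywhere.\<close>
  have "0 \<le> (\<integral>x. (f1 x * indicator R x - f1 x * indicator S x) -
                  k * (f0 x * indicator R x - f0 x * indicator S x) \<partial>M)"
    by (rule integral_nonneg_AE, use inside outside in eventually_elim)
       (auto simp: indicator_def)
  also have "\<dots> = (measure (density M f1) R - measure (density M f1) S) -
                k * (measure (density M f0) R - measure (density M f0) S)"
    using int by (simp add: measure_eq nonneg fin)
  finally show ?thesis
    by (simp add: size)
qed

text \<open>
  The comparison for an arbitrary event of \<open>(X, A)\<close> and an arbitrary region \<open>B\<close> of values of \<open>X\<close>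
  that is upper with respect to the likelihood ratio of \<open>X\<close>. Both monotone cases are instances.
\<close>

lemma ratio_upper_region_most_powerful:
  fixes P0 P1 :: "'x measure" and X A :: "'x \<Rightarrow> real"
    and Q \<nu> :: "real measure" and g0 g1 :: "real \<Rightarrow> real"
  assumes "prob_space P0" and "prob_space P1"
    and ac: "absolutely_continuous P0 P1" and sets_eq: "sets P1 = sets P0"
    and indep: "prob_space.indep_var P0 borel X borel A" "prob_space.indep_var P1 borel X borel A"
    and law_A: "distr P0 borel A = Q" "distr P1 borel A = Q"
    and "sigma_finite_measure \<nu>" and sets_\<nu>: "sets \<nu> = sets borel"
    and dens: "stat_density P0 \<nu> X g0" "stat_density P1 \<nu> X g1"
    and B: "B \<in> sets borel"
    and upper: "\<And>u v. u \<in> B \<Longrightarrow> v \<notin> B \<Longrightarrow> 0 < g0 u \<Longrightarrow> 0 < g0 v \<Longrightarrow> g1 v / g0 v \<le> g1 u / g0 u"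
    and E: "E \<in> sets (borel \<Otimes>\<^sub>M borel)"
    and size: "measure P0 {x \<in> space P0. X x \<in> B} = measure P0 {x \<in> space P0. (X x, A x) \<in> E}"
  shows "measure P1 {x \<in> space P0. (X x, A x) \<in> E} \<le> measure P1 {x \<in> space P0. X x \<in> B}"
proof -
  interpret P0: prob_space P0 by fact
  interpret P1: prob_space P1 by fact
  interpret \<nu>: sigma_finite_measure \<nu> by fact
  have space_eq: "space P1 = space P0"
    using sets_eq by (rule sets_eq_imp_space_eq)
  have meas0[measurable]: "X \<in> borel_measurable P0" "A \<in> borel_measurable P0"
    using indep(1) by (auto simp: P0.indep_var_eq)
  have meas1[measurable]: "X \<in> borel_measurable P1" "A \<in> borel_measurable P1"
    using meas0 by (simp_all add: measurable_cong_sets[OF sets_eq refl])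
  have nonneg: "0 \<le> g0 u" "0 \<le> g1 u" for u
    using dens by (auto simp: stat_density_def)
  have ennreal_meas: "(\<lambda>u. ennreal (g0 u)) \<in> borel_measurable \<nu>"
      "(\<lambda>u. ennreal (g1 u)) \<in> borel_measurable \<nu>"
    using dens by (auto simp: stat_density_def distributed_def)
  have "(\<lambda>u. enn2real (ennreal (g0 u))) \<in> borel_measurable \<nu>"
      "(\<lambda>u. enn2real (ennreal (g1 u))) \<in> borel_measurable \<nu>"
    using ennreal_meas by measurable
  then have g_meas[measurable]: "g0 \<in> borel_measurable \<nu>" "g1 \<in> borel_measurable \<nu>"
    by (simp_all add: nonneg)
  have "distr P0 borel X = distr P0 \<nu> X" "distr P1 borel X = distr P1 \<nu> X"
    by (rule distr_cong; simp add: sets_\<nu>)+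
  then have law_X: "distr P0 borel X = density \<nu> g0" "distr P1 borel X = density \<nu> g1"
    using dens by (auto simp: stat_density_def distributed_def)
  interpret Q: prob_space Q
    unfolding law_A(1)[symmetric] by (rule P0.prob_space_distr) simp
  have sets_Q: "sets Q = sets borel"
    using law_A(1) by auto

  \<comment> \<open>A value of density zero under the null hypothesis has density zero under the alternative.\<close>
  have null: "AE u in \<nu>. g0 u = 0 \<longrightarrow> g1 u = 0"
  proof -
    let ?Z = "{u \<in> space \<nu>. g0 u = 0}"
    have Z: "?Z \<in> sets \<nu>" by measurable
    then have Z': "?Z \<in> sets borel" by (simp add: sets_\<nu>)
    have "?Z \<in> null_sets (density \<nu> g0)"
      using Z by (subst null_sets_density_iff) (auto intro!: AE_I2)
    then have "X -` ?Z \<inter> space P0 \<in> null_sets P0"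
      using Z' by (auto simp: law_X(1)[symmetric] null_sets_distr_iff)
    then have "X -` ?Z \<inter> space P1 \<in> null_sets P1"
      using ac by (auto simp: absolutely_continuous_def space_eq)
    then have "?Z \<in> null_sets (density \<nu> g1)"
      using Z' by (auto simp: law_X(2)[symmetric] null_sets_distr_iff)
    then have "AE u in \<nu>. u \<in> ?Z \<longrightarrow> ennreal (g1 u) = 0"
      by (subst (asm) null_sets_density_iff) (auto simp: ennreal_meas)
    with AE_space show ?thesis
      by eventually_elim (use nonneg(2) in \<open>auto simp: ennreal_eq_0_iff intro: antisym\<close>)
  qed

  have pair_law: "distr P (borel \<Otimes>\<^sub>M borel) (\<lambda>x. (X x, A x)) = density (\<nu> \<Otimes>\<^sub>M Q) (\<lambda>z. g (fst z))"
    if P: "prob_space P" and "prob_space.indep_var P borel X borel A"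
      and "distr P borel A = Q" and "distr P borel X = density \<nu> g"
      and [measurable]: "g \<in> borel_measurable \<nu>"
    for P and g :: "real \<Rightarrow> real"
  proof -
    have "distr P (borel \<Otimes>\<^sub>M borel) (\<lambda>x. (X x, A x)) = density \<nu> g \<Otimes>\<^sub>M density Q (\<lambda>_. 1)"
      using that by (simp add: prob_space.indep_var_distribution_eq density_1)
    also have "\<dots> = density (\<nu> \<Otimes>\<^sub>M Q) (\<lambda>(u, a). ennreal (g u) * 1)"
      by (rule pair_measure_density)
         (auto simp: density_1 Q.sigma_finite_measure_axioms)
    finally show ?thesis
      by (simp add: case_prod_unfold)
  qed
  note joint0 = pair_law[OF P0.prob_space_axioms indep(1) law_A(1) law_X(1) g_meas(1)]
    and joint1 = pair_law[OF P1.prob_space_axioms indep(2) law_A(2) law_X(2) g_meas(2)]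

  let ?R = "B \<times> UNIV :: (real \<times> real) set"
  have R: "?R \<in> sets (borel \<Otimes>\<^sub>M borel)"
    using B by simp
  have prob0: "measure (density (\<nu> \<Otimes>\<^sub>M Q) (\<lambda>z. g0 (fst z))) F =
      measure P0 {x \<in> space P0. (X x, A x) \<in> F}" if "F \<in> sets (borel \<Otimes>\<^sub>M borel)" for F
    using that unfolding joint0[symmetric]
    by (subst measure_distr) (auto intro!: arg_cong[where f = "measure P0"])
  have prob1: "measure (density (\<nu> \<Otimes>\<^sub>M Q) (\<lambda>z. g1 (fst z))) F =
      measure P1 {x \<in> space P0. (X x, A x) \<in> F}" if "F \<in> sets (borel \<Otimes>\<^sub>M borel)" for F
    using that unfolding joint1[symmetric]
    by (subst measure_distr) (auto simp: space_eq intro!: arg_cong[where f = "measure P1"])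

  show ?thesis
  proof (cases "\<exists>u\<in>B. 0 < g0 u")
    case False
    \<comment> \<open>Both tests then have size zero, hence power zero.\<close>
    then have "AE u in density \<nu> g0. u \<notin> B"
      by (subst AE_density) (auto intro!: AE_I2 simp: ennreal_meas)
    then have "AE x in P0. X x \<notin> B"
      unfolding law_X(1)[symmetric] using B by (subst (asm) AE_distr_iff) auto
    then have "measure P0 {x \<in> space P0. X x \<in> B} = 0"
      by (intro P0.prob_eq_0_AE)
    then have "measure P0 {x \<in> space P0. (X x, A x) \<in> E} = 0"
      using size by simp
    moreover have "{x \<in> space P0. (X x, A x) \<in> E} \<in> sets P0"
      using E by measurable
    ultimately have "{x \<in> space P0. (X x, A x) \<in> E} \<in> null_sets P0"
      by (auto simp: P0.emeasure_eq_measure)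
    then have "{x \<in> space P0. (X x, A x) \<in> E} \<in> null_sets P1"
      using ac by (auto simp: absolutely_continuous_def)
    then show ?thesis
      by (simp add: measure_eq_0_null_sets)
  next
    case True
    \<comment> \<open>The critical value is the infimum of the ratios in the region, which dominates the ratios
      outside it by \<open>upper\<close> and is finite because the region contains a point of positive density.\<close>
    define k where "k = (INF u\<in>{u \<in> B. 0 < g0 u}. g1 u / g0 u)"
    have bdd: "bdd_below ((\<lambda>u. g1 u / g0 u) ` {u \<in> B. 0 < g0 u})"
      by (rule bdd_belowI2[where m = 0]) (simp add: nonneg)
    have k_inside: "k * g0 u \<le> g1 u" if "u \<in> B" "0 < g0 u" for u
    proof -
      have "k \<le> g1 u / g0 u"
        unfolding k_def using bdd that by (intro cINF_lower) auto
      with that show ?thesis by (simp add: pos_le_divide_eq)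
    qed
    have k_outside: "g1 v \<le> k * g0 v" if "v \<notin> B" "0 < g0 v" for v
    proof -
      have "g1 v / g0 v \<le> k"
        unfolding k_def using True that upper by (intro cINF_greatest) auto
      with that show ?thesis by (simp add: pos_divide_le_eq)
    qed
    let ?opt = "\<lambda>u. (u \<in> B \<longrightarrow> k * g0 u \<le> g1 u) \<and> (u \<notin> B \<longrightarrow> g1 u \<le> k * g0 u)"
    have AE_opt: "AE u in \<nu>. ?opt u"
      using null
    proof eventually_elim
      case (elim u)
      then show ?case
        using k_inside[of u] k_outside[of u] nonneg(1)[of u] by (cases "g0 u = 0") auto
    qed
    have AE_fst: "AE z in \<nu> \<Otimes>\<^sub>M Q. ?opt (fst z)"
    proof -
      interpret pair_sigma_finite \<nu> Q ..
      have [measurable]: "B \<in> sets \<nu>" using B sets_\<nu> by simp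
      have "{z \<in> space (\<nu> \<Otimes>\<^sub>M Q). ?opt (fst z)} \<in> sets (\<nu> \<Otimes>\<^sub>M Q)"
        by measurable
      moreover have "AE u in \<nu>. AE a in Q. ?opt (fst (u, a))"
        using AE_opt by eventually_elim simp
      ultimately show ?thesis
        by (rule AE_pair_measure)
    qed
    have sets_prod: "sets (\<nu> \<Otimes>\<^sub>M Q) = sets (borel \<Otimes>\<^sub>M borel)"
      by (rule sets_pair_measure_cong) (simp_all add: sets_\<nu> sets_Q)
    have fin: "finite_measure (density (\<nu> \<Otimes>\<^sub>M Q) (\<lambda>z. g0 (fst z)))"
        "finite_measure (density (\<nu> \<Otimes>\<^sub>M Q) (\<lambda>z. g1 (fst z)))"
      unfolding joint0[symmetric] joint1[symmetric]
      by (intro P0.finite_measure_distr P1.finite_measure_distr; measurable)+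
    have "measure (density (\<nu> \<Otimes>\<^sub>M Q) (\<lambda>z. g1 (fst z))) E
        \<le> measure (density (\<nu> \<Otimes>\<^sub>M Q) (\<lambda>z. g1 (fst z))) ?R"
    proof (rule neyman_pearson_densities[where ?f0.0 = "\<lambda>z. g0 (fst z)" and k = k])
      show "measure (density (\<nu> \<Otimes>\<^sub>M Q) (\<lambda>z. g0 (fst z))) ?R
          = measure (density (\<nu> \<Otimes>\<^sub>M Q) (\<lambda>z. g0 (fst z))) E"
        using size by (simp add: prob0 R E)
      show "AE z in \<nu> \<Otimes>\<^sub>M Q. z \<in> ?R \<longrightarrow> k * g0 (fst z) \<le> g1 (fst z)"
        using AE_fst by eventually_elim auto
      show "AE z in \<nu> \<Otimes>\<^sub>M Q. z \<notin> ?R \<longrightarrow> g1 (fst z) \<le> k * g0 (fst z)"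
        using AE_fst by eventually_elim auto
    qed (use fin R E in \<open>simp_all add: nonneg sets_prod\<close>)
    then show ?thesis
      by (simp add: prob1 R E)
  qed
qed

theorem proposition3p1:
  fixes \<tau> P0 P1 :: "'x measure" and f0 f1 :: "'x \<Rightarrow> real"
    and A T TN :: "'x \<Rightarrow> real" and \<psi> :: "real \<times> real \<Rightarrow> real"
    and \<nu>A \<nu>N :: "real measure" and gA0 gA1 gN0 gN1 :: "real \<Rightarrow> real"
  assumes "sigma_finite_measure \<tau>"
    and "f0 \<in> borel_measurable \<tau>" and "f1 \<in> borel_measurable \<tau>"
    and "\<And>x. x \<in> space \<tau> \<Longrightarrow> 0 < f0 x" and "\<And>x. x \<in> space \<tau> \<Longrightarrow> 0 < f1 x"
    and "P0 = density \<tau> (\<lambda>x. ennreal (f0 x))" and "P1 = density \<tau> (\<lambda>x. ennreal (f1 x))"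
    and "prob_space P0" and "prob_space P1"
    and "A \<in> borel_measurable \<tau>" and "T \<in> borel_measurable \<tau>" and "TN \<in> borel_measurable \<tau>"
    and "sigma_finite_measure \<nu>A" and "sets \<nu>A = sets borel"
    and "stat_density P0 \<nu>A A gA0" and "stat_density P1 \<nu>A A gA1"
    and "AE u in \<nu>A. gA1 u = gA0 u"
    and "prob_space.indep_var P0 borel TN borel A"
    and "prob_space.indep_var P1 borel TN borel A"
    and "\<psi> \<in> borel_measurable (borel \<Otimes>\<^sub>M borel)"
    and "\<And>x. x \<in> space \<tau> \<Longrightarrow> T x = \<psi> (TN x, A x)"
    and "sigma_finite_measure \<nu>N" and "sets \<nu>N = sets borel"
    and "stat_density P0 \<nu>N TN gN0" and "stat_density P1 \<nu>N TN gN1"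
    and "increasing_ratio gN0 gN1 \<or> decreasing_ratio gN0 gN1"
  shows "(increasing_ratio gN0 gN1 \<longrightarrow>
            superior P0 P1 (reject_large \<tau> TN) (reject_large \<tau> T)) \<and>
         (decreasing_ratio gN0 gN1 \<longrightarrow>
            superior P0 P1 (reject_small \<tau> TN) (reject_large \<tau> T))"
proof -
  note P0_def = assms(6) and P1_def = assms(7)
  note pos = assms(4,5)
  have [measurable]: "f0 \<in> borel_measurable \<tau>" "f1 \<in> borel_measurable \<tau>"
    by fact+
  note [measurable] = assms(20)
  have sets_eq: "sets P1 = sets P0" and space0: "space P0 = space \<tau>"
    by (simp_all add: P0_def P1_def)
  have "null_sets P0 \<subseteq> null_sets P1"
  proof
    fix N assume "N \<in> null_sets P0"
    then have "N \<in> sets \<tau>" "AE x in \<tau>. x \<in> N \<longrightarrow> ennreal (f0 x) = 0"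
      unfolding P0_def by (simp_all add: null_sets_density_iff)
    moreover from this(2) AE_space have "AE x in \<tau>. x \<in> N \<longrightarrow> ennreal (f1 x) = 0"
    proof eventually_elim
      case (elim x)
      then show ?case using pos(1)[of x] by (auto simp: ennreal_eq_0_iff)
    qed
    ultimately show "N \<in> null_sets P1"
      unfolding P1_def by (simp add: null_sets_density_iff)
  qed
  then have ac: "absolutely_continuous P0 P1"
    by (simp add: absolutely_continuous_def)

  have same_law_A: "distr P1 borel A = distr P0 borel A"
  proof -
    have law: "distr P borel A = density \<nu>A g"
      if "stat_density P \<nu>A A g" for P and g :: "real \<Rightarrow> real"
    proof -
      have "distr P borel A = distr P \<nu>A A"
        by (rule distr_cong) (simp_all add: assms(14))
      with that show ?thesis
        by (simp add: stat_density_def distributed_def)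
    qed
    have "density \<nu>A gA1 = density \<nu>A gA0"
      using assms(15-17) by (intro density_cong) (auto simp: stat_density_def distributed_def)
    then show ?thesis
      using law[OF assms(15)] law[OF assms(16)] by simp
  qed

  have compare: "measure P1 {x \<in> space \<tau>. T x > C} \<le> measure P1 {x \<in> space \<tau>. TN x \<in> B}"
    if "B \<in> sets borel"
      and "\<And>u v. u \<in> B \<Longrightarrow> v \<notin> B \<Longrightarrow> 0 < gN0 u \<Longrightarrow> 0 < gN0 v \<Longrightarrow> gN1 v / gN0 v \<le> gN1 u / gN0 u"
      and size: "measure P0 {x \<in> space \<tau>. TN x \<in> B} = measure P0 {x \<in> space \<tau>. T x > C}"
    for B C
  proof -
    let ?E = "{z \<in> space (borel \<Otimes>\<^sub>M borel). \<psi> z > C}"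
    have E: "?E \<in> sets (borel \<Otimes>\<^sub>M borel)"
      by measurable
    have T_eq: "{x \<in> space P0. (TN x, A x) \<in> ?E} = {x \<in> space \<tau>. T x > C}"
      by (auto simp: space0 assms(21) space_pair_measure)
    have "measure P1 {x \<in> space P0. (TN x, A x) \<in> ?E} \<le> measure P1 {x \<in> space P0. TN x \<in> B}"
    proof (rule ratio_upper_region_most_powerful[OF assms(8,9) ac sets_eq assms(18,19) refl
          same_law_A assms(22-25) that(1) _ E])
      show "measure P0 {x \<in> space P0. TN x \<in> B} = measure P0 {x \<in> space P0. (TN x, A x) \<in> ?E}"
        unfolding T_eq using size by (simp only: space0)
    qed (fact that(2))
    then show ?thesis
      unfolding T_eq by (simp only: space0)
  qed

  show ?thesis
  proof (intro conjI impI)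
    assume inc: "increasing_ratio gN0 gN1"
    show "superior P0 P1 (reject_large \<tau> TN) (reject_large \<tau> T)"
      unfolding superior_def reject_large_def
    proof (clarify)
      fix C C'
      assume "measure P0 {x \<in> space \<tau>. TN x > C} = measure P0 {x \<in> space \<tau>. T x > C'}"
      then show "measure P1 {x \<in> space \<tau>. T x > C'} \<le> measure P1 {x \<in> space \<tau>. TN x > C}"
        using compare[of "{C<..}" C'] inc
        by (auto simp: increasing_ratio_def mono_on_def)
    qed
  next
    assume dec: "decreasing_ratio gN0 gN1"
    show "superior P0 P1 (reject_small \<tau> TN) (reject_large \<tau> T)"
      unfolding superior_def reject_large_def reject_small_def
    proof (clarify)
      fix C C'
      assume "measure P0 {x \<in> space \<tau>. TN x < C} = measure P0 {x \<in> space \<tau>. T x > C'}"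
      then show "measure P1 {x \<in> space \<tau>. T x > C'} \<le> measure P1 {x \<in> space \<tau>. TN x < C}"
        using compare[of "{..<C}" C'] dec
        by (auto simp: decreasing_ratio_def monotone_on_def)
    qed
  qed
qed

end
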